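(* Let $a,b$ be real numbers with $0<a\le b$. Then for all $\lambda\in[0,1]$, $$\frac{\lambda(1-\lambda)a}{2}\log^2\left(\frac{a}{b}\right)\le \lambda a+(1-\lambda)b-a^{\lambda}b^{1-\lambda}\le \frac{\lambda(1-\lambda)b}{2}\log^2\left(\frac{a}{b}\right).$$
   Context: $\log$ denotes the natural logarithm and $\log^2(u)=(\log u)^2$. *)

theory Defs
  imports Complex_Main
begin

end

theory Submission
  imports Defs "HOL-Analysis.Convex"
begin

text \<open>
  With \<open>x = ln a\<close> and \<open>y = ln b\<close>, the quantity to be estimated is the Jensen gap
  \<open>\<nu> * exp x + (1 - \<nu>) * exp y - exp (\<nu> * x + (1 - \<nu>) * y)\<close> of the exponential function.
  The Jensen gap is linear in the function, and the gap of \<open>c * t\<^sup>2 / 2\<close> is exactly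
  \<open>\<nu> * (1 - \<nu>) * c / 2 * (x - y)\<^sup>2\<close>. On \<open>{x..y}\<close> the second derivative of \<open>exp\<close>
  lies between \<open>exp x = a\<close> and \<open>exp y = b\<close>, so comparing \<open>exp\<close> with the parabolas of constant
  second derivative \<open>a\<close> and \<open>b\<close> yields the two bounds (\<open>jensen_gap_lower\<close>, \<open>jensen_gap_upper\<close>).
\<close>

text \<open>
  Subtracting \<open>m * t\<^sup>2 / 2\<close> from \<open>f\<close> leaves a nonnegative second derivative, hence a convex
  function, whose Jensen gap is nonnegative.
\<close>
lemma jensen_gap_lower:
  fixes f f' f'' :: "real \<Rightarrow> real"
  assumes "convex S"
    and f': "\<And>t. t \<in> S \<Longrightarrow> (f has_real_derivative f' t) (at t)"
    and f'': "\<And>t. t \<in> S \<Longrightarrow> (f' has_real_derivative f'' t) (at t)"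
    and m: "\<And>t. t \<in> S \<Longrightarrow> m \<le> f'' t"
    and "x \<in> S" "y \<in> S" "0 \<le> u" "u \<le> 1"
  shows "u * (1 - u) * m / 2 * (x - y)\<^sup>2 \<le> u * f x + (1 - u) * f y - f (u * x + (1 - u) * y)"
proof -
  let ?g = "\<lambda>t. f t - m / 2 * t\<^sup>2"
  have "convex_on S ?g"
  proof (rule f''_ge0_imp_convex[OF \<open>convex S\<close>])
    fix t assume t: "t \<in> S"
    show "(?g has_real_derivative f' t - m * t) (at t)"
      using f'[OF t] by (auto intro!: derivative_eq_intros)
    show "((\<lambda>t. f' t - m * t) has_real_derivative f'' t - m) (at t)"
      using f''[OF t] by (auto intro!: derivative_eq_intros)
    show "0 \<le> f'' t - m"
      using m[OF t] by simp
  qed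
  then have "?g (u * x + (1 - u) * y) \<le> u * ?g x + (1 - u) * ?g y"
    using assms(5-8) by (auto simp: convex_on_def)
  moreover have "u * (m / 2 * x\<^sup>2) + (1 - u) * (m / 2 * y\<^sup>2) - m / 2 * (u * x + (1 - u) * y)\<^sup>2
      = u * (1 - u) * m / 2 * (x - y)\<^sup>2"
    by (simp add: field_simps power2_eq_square)
  ultimately show ?thesis
    by (simp add: right_diff_distrib)
qed

lemma jensen_gap_upper:
  fixes f f' f'' :: "real \<Rightarrow> real"
  assumes "convex S"
    and "\<And>t. t \<in> S \<Longrightarrow> (f has_real_derivative f' t) (at t)"
    and "\<And>t. t \<in> S \<Longrightarrow> (f' has_real_derivative f'' t) (at t)"
    and "\<And>t. t \<in> S \<Longrightarrow> f'' t \<le> M"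
    and "x \<in> S" "y \<in> S" "0 \<le> u" "u \<le> 1"
  shows "u * f x + (1 - u) * f y - f (u * x + (1 - u) * y) \<le> u * (1 - u) * M / 2 * (x - y)\<^sup>2"
proof -
  have "u * (1 - u) * (- M) / 2 * (x - y)\<^sup>2
      \<le> u * (- f x) + (1 - u) * (- f y) - (- f (u * x + (1 - u) * y))"
    using assms by (intro jensen_gap_lower[of S "\<lambda>t. - f t" "\<lambda>t. - f' t" "\<lambda>t. - f'' t"])
      (auto intro!: DERIV_minus)
  then show ?thesis
    by simp
qed

theorem mainTheorem5:
  fixes a b :: real
  assumes "0 < a" and "a \<le> b"
  shows "\<forall>\<nu>\<in>{0..1::real}.
      \<nu> * (1 - \<nu>) * a / 2 * (ln (a / b))\<^sup>2 \<le> \<nu> * a + (1 - \<nu>) * b - a powr \<nu> * b powr (1 - \<nu>) \<and>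
      \<nu> * a + (1 - \<nu>) * b - a powr \<nu> * b powr (1 - \<nu>) \<le> \<nu> * (1 - \<nu>) * b / 2 * (ln (a / b))\<^sup>2"
proof
  fix \<nu> :: real
  assume "\<nu> \<in> {0..1}"
  then have \<nu>: "0 \<le> \<nu>" "\<nu> \<le> 1" by auto
  have b: "0 < b" using assms by simp
  let ?S = "{ln a..ln b}"
  have bounds: "a \<le> exp t" "exp t \<le> b" if "t \<in> ?S" for t
    using that assms(1) b exp_le_cancel_iff[of "ln a" t] exp_le_cancel_iff[of t "ln b"] by simp_all
  have ends: "ln a \<in> ?S" "ln b \<in> ?S" using assms b by auto
  have geo: "a powr \<nu> * b powr (1 - \<nu>) = exp (\<nu> * ln a + (1 - \<nu>) * ln b)"
    using assms(1) b by (simp add: powr_def exp_add)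
  have log: "ln (a / b) = ln a - ln b" using assms(1) b by (simp add: ln_div)
  have "\<nu> * (1 - \<nu>) * a / 2 * (ln a - ln b)\<^sup>2
      \<le> \<nu> * exp (ln a) + (1 - \<nu>) * exp (ln b) - exp (\<nu> * ln a + (1 - \<nu>) * ln b)"
    using bounds(1) ends \<nu> by (intro jensen_gap_lower[of ?S exp exp exp]) (auto intro: DERIV_exp)
  moreover have "\<nu> * exp (ln a) + (1 - \<nu>) * exp (ln b) - exp (\<nu> * ln a + (1 - \<nu>) * ln b)
      \<le> \<nu> * (1 - \<nu>) * b / 2 * (ln a - ln b)\<^sup>2"
    using bounds(2) ends \<nu> by (intro jensen_gap_upper[of ?S exp exp exp]) (auto intro: DERIV_exp)
  ultimately show "\<nu> * (1 - \<nu>) * a / 2 * (ln (a / b))\<^sup>2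
        \<le> \<nu> * a + (1 - \<nu>) * b - a powr \<nu> * b powr (1 - \<nu>) \<and>
      \<nu> * a + (1 - \<nu>) * b - a powr \<nu> * b powr (1 - \<nu>) \<le> \<nu> * (1 - \<nu>) * b / 2 * (ln (a / b))\<^sup>2"
    using assms(1) b by (simp add: geo log)
qed

end
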